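(* Let $\mu>0$, $\tau>0$, and let $f:[0,\infty)\to[0,\infty)$ be a continuous function satisfying condition (U) with critical point $x_0$. Put $g=\mu^{-1}f$, suppose $g'(0)>1$, and suppose that the unique positive fixed point $K$ of $g$ satisfies $K>x_0$. Write $g^2=g\circ g$ and $g_1(x)=(1-e^{-\mu\tau})g(x)+e^{-\mu\tau}K$. Assume that the condition $g^2(x_0)>x_0$ does not hold. If $$\tau<\tau^*:=\frac{\Pi(x_0)-x_0}{\mu\,\bigl(g(x_0)-g^2(x_0)\bigr)},$$ then $$g_1(g_1(x_0))>x_0 .$$
   Context: Condition (U): $f(x)\ge 0$ for all $x\ge 0$, $f(0)=0$, and there is a unique $x_0>0$ such that $f'(x)>0$ if $0\le x<x_0$, $f'(x_0)=0$, and $f'(x)<0$ if $x>x_0$; moreover $f''(x)<0$ for $0\le x\le x_0$. Under (U) with $g'(0)>1$, the fixed points of $g$ are exactly $0$ and one positive point $K$. $\Pi$ denotes the inverse of the restriction of $g$ to $[K,\infty)$ (on which $g$ is strictly decreasing); so $\Pi(x_0)$ is the unique $y\ge K$ with $g(y)=x_0$, which exists because $g^2(x_0)\le x_0<K$. *)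

theory Defs
  imports "HOL-Analysis.Analysis"
begin

text \<open>
  A function \<open>[0, \<infinity>) \<rightarrow> [0, \<infinity>)\<close> is represented by a total function on the reals of which only
  the values on \<open>{0..}\<close> are used. Derivatives are taken within \<open>{0..}\<close>, i.e. they are one-sided at
  \<open>0\<close> and ordinary at every positive point.
\<close>

definition unimodal_sign :: "(real \<Rightarrow> real) \<Rightarrow> real \<Rightarrow> bool" where
  "unimodal_sign f' c \<longleftrightarrow>
     0 < c \<and> (\<forall>x. 0 \<le> x \<and> x < c \<longrightarrow> 0 < f' x) \<and> f' c = 0 \<and> (\<forall>x>c. f' x < 0)"

text \<open>
  The second argument of \<open>condition_U\<close> is the critical point whose unique existence the
  condition requires.
\<close>

definition condition_U :: "(real \<Rightarrow> real) \<Rightarrow> real \<Rightarrow> bool" where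
  "condition_U f x0 \<longleftrightarrow>
     (\<forall>x\<ge>0. 0 \<le> f x) \<and> f 0 = 0 \<and>
     (\<exists>f' f''.
        (\<forall>x\<ge>0. (f has_real_derivative f' x) (at x within {0..})) \<and>
        unimodal_sign f' x0 \<and> (\<exists>!c. unimodal_sign f' c) \<and>
        (\<forall>x\<in>{0..x0}. (f' has_real_derivative f'' x) (at x within {0..}) \<and> f'' x < 0))"

end

theory Submission
  imports Defs
begin

text \<open>
  Write \<open>s = 1 - exp (- \<mu> \<tau>)\<close>, \<open>M = g x0\<close>, \<open>m = g M\<close>, \<open>P = \<Pi> x0\<close> and \<open>y = g1 x0\<close>. Since
  \<open>g1 = K + s (g - K)\<close>, the point \<open>y\<close> lies between \<open>K\<close> and \<open>M\<close>, and the claim \<open>x0 < g1 y\<close> says that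
  \<open>s (K - g y) < K - x0\<close>. Everything takes place on \<open>[x0, \<infinity>)\<close>, where \<open>g\<close> strictly decreases; this
  yields \<open>x0 < K < M\<close>, and with \<open>m \<le> x0 < K\<close> the intermediate value theorem places \<open>P\<close> in
  \<open>[K, M]\<close>.

  If \<open>y \<le> P\<close>, then \<open>g y \<ge> g P = x0\<close>, so \<open>g1 y\<close> is an average, with positive weight on \<open>K\<close>, of \<open>K\<close>
  and a number that is at least \<open>x0\<close>. If \<open>y > P\<close>, then only \<open>g y \<ge> m\<close> is known, but two estimates
  become available: \<open>s (M - K) = y - K > P - K\<close>, and, from \<open>s \<le> \<mu> \<tau>\<close> and the bound on \<open>\<tau>\<close>,
  \<open>s (M - m) < P - x0\<close>. Subtracting the first from the second cancels \<open>P\<close> and \<open>M\<close> and leaves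
  exactly \<open>s (K - m) < K - x0\<close>.
\<close>

lemma condition_U_strict_decreasing:
  assumes U: "condition_U f c" and xy: "c \<le> x" "x < y"
  shows "f y < f x"
proof -
  obtain f' where d: "\<And>x. x \<ge> 0 \<Longrightarrow> (f has_real_derivative f' x) (at x within {0..})"
    and uni: "unimodal_sign f' c"
    using U unfolding condition_U_def by metis
  have c: "0 < c" and neg: "\<And>x. x > c \<Longrightarrow> f' x < 0"
    using uni unfolding unimodal_sign_def by auto
  have d_at: "(f has_real_derivative f' z) (at z)" if "z > 0" for z
    using d[of z] that at_within_interior[of z "{0..}"] by simp
  \<comment> \<open>The derivative vanishes at \<open>c\<close> itself, so only the open interval can be used.\<close>
  show ?thesis
  proof (rule DERIV_neg_imp_decreasing_open[OF xy(2)])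
    show "\<exists>d. (f has_real_derivative d) (at z) \<and> d < 0" if "x < z" "z < y" for z
      using d_at[of z] neg[of z] that xy c by force
    show "continuous_on {x..y} f"
      using d_at xy c
      by (intro DERIV_continuous_on[of _ _ f']) (auto intro: has_field_derivative_at_within)
  qed
qed

text \<open>
  The dichotomy described above, for an arbitrary weight \<open>s\<close>. The hypothesis \<open>bound\<close> is what remains
  of the smallness of the delay once \<open>1 - exp (- \<mu> \<tau>)\<close> has been estimated by \<open>\<mu> \<tau>\<close>.
\<close>

lemma averaged_decreasing_map_second_iterate_gt:
  fixes g :: "real \<Rightarrow> real"
  assumes decr: "\<And>x y. c \<le> x \<Longrightarrow> x < y \<Longrightarrow> g y < g x"
    and K: "c < K" "g K = K"
    and P: "K \<le> P" "g P = c"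
    and s: "0 < s" "s < 1"
    and bound: "s * (g c - g (g c)) < P - c"
  defines "h \<equiv> \<lambda>x. s * g x + (1 - s) * K"
  shows "c < h (h c)"
proof -
  let ?M = "g c" and ?y = "h c"
  have decr_le: "g y \<le> g x" if "c \<le> x" "x \<le> y" for x y
    using decr[of x y] that by (cases "x = y") auto
  have y_minus_K: "?y - K = s * (?M - K)"
    by (simp add: h_def algebra_simps)
  have M: "K < ?M"
    using decr[of c K] K by simp
  then have y: "K < ?y"
    using y_minus_K s by (metis diff_gt_0_iff_gt mult_pos_pos)
  have "?y - K \<le> ?M - K"
    using y_minus_K s M by (simp add: mult_left_le_one_le)
  then have "g ?M \<le> g ?y"
    using decr_le[of ?y ?M] y K by simp
  have "s * (K - g ?y) < K - c"
  proof (cases "?y \<le> P")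
    case True
    then have "c \<le> g ?y"
      using decr_le[of ?y P] y K P by simp
    then have "s * (K - g ?y) \<le> s * (K - c)"
      using s by (intro mult_left_mono) auto
    also have "\<dots> < K - c"
      using s K by simp
    finally show ?thesis .
  next
    case False
    then have "P - K < s * (?M - K)"
      using y_minus_K by linarith
    then have "s * (K - g ?M) < K - c"
      using bound by (simp add: algebra_simps)
    moreover have "s * (K - g ?y) \<le> s * (K - g ?M)"
      using s \<open>g ?M \<le> g ?y\<close> by (intro mult_left_mono) auto
    ultimately show ?thesis
      by linarith
  qed
  then have "c < s * g ?y + (1 - s) * K"
    by (simp add: algebra_simps)
  then show ?thesis
    by (simp add: h_def)
qed

theorem proposition10:
  fixes \<mu> \<tau> x0 K g'0 :: real and f g g1 Pinv :: "real \<Rightarrow> real"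
  assumes mu: "\<mu> > 0" and tau: "\<tau> > 0"
    and f_cont: "continuous_on {0..} f"
    and f_U: "condition_U f x0"
    and g_def: "g = (\<lambda>x. inverse \<mu> * f x)"
    and g_deriv: "(g has_real_derivative g'0) (at 0 within {0..})" "g'0 > 1"
    and K_pos: "K > 0" and K_fix: "g K = K"
    and K_unique: "\<And>x. x > 0 \<Longrightarrow> g x = x \<Longrightarrow> x = K"
    and K_gt: "K > x0"
    and g1_def: "g1 = (\<lambda>x. (1 - exp (- (\<mu> * \<tau>))) * g x + exp (- (\<mu> * \<tau>)) * K)"
    and Pinv_def: "Pinv = the_inv_into {K..} g"
    and not_cond: "\<not> (g \<circ> g) x0 > x0"
    and tau_less: "\<tau> < (Pinv x0 - x0) / (\<mu> * (g x0 - (g \<circ> g) x0))"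
  shows "g1 (g1 x0) > x0"
proof -
  define s where "s = 1 - exp (- (\<mu> * \<tau>))"
  have decr: "g y < g x" if "x0 \<le> x" "x < y" for x y
    using condition_U_strict_decreasing[OF f_U that] mu by (simp add: g_def)
  have M: "K < g x0"
    using decr[of x0 K] K_gt K_fix by simp
  have m: "g (g x0) \<le> x0"
    using not_cond by simp
  have "continuous_on {K..g x0} g"
    unfolding g_def using f_cont K_pos
    by (intro continuous_intros) (auto intro: continuous_on_subset)
  then obtain P where P: "K \<le> P" "g P = x0"
    using IVT2'[of g "g x0" x0 K] m M K_gt K_fix by auto
  have "inj_on g {K..}"
  proof (rule linorder_inj_onI)
    show "g x \<noteq> g y" if "x < y" "x \<in> {K..}" for x y
      using decr[of x y] that K_gt by simp
  qed auto
  then have Pinv: "Pinv x0 = P"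
    unfolding Pinv_def using P by (intro the_inv_into_f_eq) auto
  have s: "0 < s" "s < 1"
    using mu tau by (auto simp: s_def)
  have gap: "0 < g x0 - g (g x0)"
    using m M K_gt by linarith
  have "s \<le> \<mu> * \<tau>"
    using exp_ge_add_one_self[of "- (\<mu> * \<tau>)"] by (simp add: s_def)
  then have "s * (g x0 - g (g x0)) \<le> \<mu> * \<tau> * (g x0 - g (g x0))"
    using gap by (intro mult_right_mono) auto
  also have "\<dots> < P - x0"
    using tau_less Pinv mu gap by (simp add: pos_less_divide_eq mult.assoc mult.left_commute)
  finally have "x0 < s * g (s * g x0 + (1 - s) * K) + (1 - s) * K"
    using averaged_decreasing_map_second_iterate_gt[of x0 g K P s] decr K_gt K_fix P s by blast
  then show ?thesis
    by (simp add: g1_def s_def)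
qed

end
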